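(* Let $V$ be a finite-dimensional irreducible $\boxtimes$-module over $\mathbb F$ and let $\langle\,,\rangle$ be a nonzero bilinear form on $V$ such that $\langle\xi.u,v\rangle=-\langle u,\xi.v\rangle$ for all $\xi\in\boxtimes$ and $u,v\in V$. Then there exists an isomorphism of $\boxtimes$-modules $\varphi:V\to V^*$ such that $$\varphi(u)(v)=\langle u,v\rangle\qquad\text{for all }u,v\in V.$$
   Context: $\mathbb F$ is an algebraically closed field of characteristic $0$, and $\mathbb I=\{0,1,2,3\}$. The tetrahedron algebra $\boxtimes$ is the Lie algebra over $\mathbb F$ with generators $\{x_{ij}\mid i,j\in\mathbb I,\ i\ne j\}$ and relations: (i) $x_{ij}+x_{ji}=0$ for distinct $i,j$; (ii) $[x_{ij},x_{jk}]=2x_{ij}+2x_{jk}$ for mutually distinct $i,j,k$; (iii) $[x_{ij},[x_{ij},[x_{ij},x_{k\ell}]]]=4[x_{ij},x_{k\ell}]$ for mutually distinct $i,j,k,\ell$. $V^*$ is the dual space of $V$, with the $\boxtimes$-module structure $(\xi.f)(v)=-f(\xi.v)$ for $\xi\in\boxtimes$, $f\in V^*$, $v\in V$. A nonzero form of the stated kind exists on every finite-dimensional irreducible $\boxtimes$-module, and is unique up to a nonzero scalar. *)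

theory Defs
  imports
    "HOL-Library.Function_Algebras"
    "HOL-Library.Numeral_Type"
    "HOL-Computational_Algebra.Polynomial"
begin

section \<open>Lie algebras and their modules\<close>

locale lie_algebra = vector_space scl
  for scl :: "'f::field \<Rightarrow> 'l::ab_group_add \<Rightarrow> 'l" +
  fixes br :: "'l \<Rightarrow> 'l \<Rightarrow> 'l"
  assumes br_add_left: "br (x + y) z = br x z + br y z"
    and br_add_right: "br x (y + z) = br x y + br x z"
    and br_scale_left: "br (scl c x) y = scl c (br x y)"
    and br_scale_right: "br x (scl c y) = scl c (br x y)"
    and br_self: "br x x = 0"
    and jacobi: "br x (br y z) + br y (br z x) + br z (br x y) = 0"

text \<open>
  The underlying space of a module is a subspace \<open>V\<close> of an ambient vector space, so that
  submodules and the dual module are instances of the same notion. The values of \<open>act\<close>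
  outside \<open>V\<close> are irrelevant.
\<close>

locale lie_module = L: lie_algebra scl br + M: vector_space scv
  for scl :: "'f::field \<Rightarrow> 'l::ab_group_add \<Rightarrow> 'l"
    and br :: "'l \<Rightarrow> 'l \<Rightarrow> 'l"
    and scv :: "'f \<Rightarrow> 'v::ab_group_add \<Rightarrow> 'v" +
  fixes V :: "'v set"
    and act :: "'l \<Rightarrow> 'v \<Rightarrow> 'v"
  assumes subspace: "M.subspace V"
    and act_closed: "v \<in> V \<Longrightarrow> act x v \<in> V"
    and act_add_left: "v \<in> V \<Longrightarrow> act (x + y) v = act x v + act y v"
    and act_scale_left: "v \<in> V \<Longrightarrow> act (scl c x) v = scv c (act x v)"
    and act_add_right: "u \<in> V \<Longrightarrow> v \<in> V \<Longrightarrow> act x (u + v) = act x u + act x v"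
    and act_scale_right: "v \<in> V \<Longrightarrow> act x (scv c v) = scv c (act x v)"
    and act_br: "v \<in> V \<Longrightarrow> act (br x y) v = act x (act y v) - act y (act x v)"

definition irreducible_lie_module ::
  "('f::field \<Rightarrow> 'l::ab_group_add \<Rightarrow> 'l) \<Rightarrow> ('l \<Rightarrow> 'l \<Rightarrow> 'l) \<Rightarrow>
   ('f \<Rightarrow> 'v::ab_group_add \<Rightarrow> 'v) \<Rightarrow> 'v set \<Rightarrow> ('l \<Rightarrow> 'v \<Rightarrow> 'v) \<Rightarrow> bool" where
  "irreducible_lie_module scl br scv V act \<longleftrightarrow>
     lie_module scl br scv V act \<and> V \<noteq> {0} \<and>
     (\<forall>W. W \<subseteq> V \<and> lie_module scl br scv W act \<longrightarrow> W = {0} \<or> W = V)"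

definition finite_dimensional ::
  "('f::field \<Rightarrow> 'v::ab_group_add \<Rightarrow> 'v) \<Rightarrow> 'v set \<Rightarrow> bool" where
  "finite_dimensional scv V \<longleftrightarrow> (\<exists>B. finite B \<and> B \<subseteq> V \<and> module.span scv B = V)"

locale lie_module_iso =
  M: lie_module scl br scv V act + N: lie_module scl br scw W act'
  for scl :: "'f::field \<Rightarrow> 'l::ab_group_add \<Rightarrow> 'l"
    and br :: "'l \<Rightarrow> 'l \<Rightarrow> 'l"
    and scv :: "'f \<Rightarrow> 'v::ab_group_add \<Rightarrow> 'v"
    and V :: "'v set"
    and act :: "'l \<Rightarrow> 'v \<Rightarrow> 'v"
    and scw :: "'f \<Rightarrow> 'w::ab_group_add \<Rightarrow> 'w"
    and W :: "'w set"
    and act' :: "'l \<Rightarrow> 'w \<Rightarrow> 'w" +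
  fixes \<phi> :: "'v \<Rightarrow> 'w"
  assumes bij: "bij_betw \<phi> V W"
    and add: "u \<in> V \<Longrightarrow> v \<in> V \<Longrightarrow> \<phi> (u + v) = \<phi> u + \<phi> v"
    and scale: "v \<in> V \<Longrightarrow> \<phi> (scv c v) = scw c (\<phi> v)"
    and equivariant: "v \<in> V \<Longrightarrow> \<phi> (act x v) = act' x (\<phi> v)"


section \<open>Dual module and bilinear forms\<close>

text \<open>The dual of a module whose underlying space is a whole type.\<close>

definition dual_space ::
  "('f::field \<Rightarrow> 'v::ab_group_add \<Rightarrow> 'v) \<Rightarrow> ('v \<Rightarrow> 'f) set" where
  "dual_space scv = {f. Vector_Spaces.linear scv (*) f}"

definition dual_scale :: "'f::field \<Rightarrow> ('v \<Rightarrow> 'f) \<Rightarrow> 'v \<Rightarrow> 'f" where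
  "dual_scale c f = (\<lambda>v. c * f v)"

definition dual_act :: "('l \<Rightarrow> 'v \<Rightarrow> 'v) \<Rightarrow> 'l \<Rightarrow> ('v \<Rightarrow> 'f::field) \<Rightarrow> 'v \<Rightarrow> 'f" where
  "dual_act act x f = (\<lambda>v. - f (act x v))"

definition bilinear_form ::
  "('f::field \<Rightarrow> 'v::ab_group_add \<Rightarrow> 'v) \<Rightarrow> ('v \<Rightarrow> 'v \<Rightarrow> 'f) \<Rightarrow> bool" where
  "bilinear_form scv b \<longleftrightarrow>
     (\<forall>u. Vector_Spaces.linear scv (*) (\<lambda>v. b u v)) \<and>
     (\<forall>v. Vector_Spaces.linear scv (*) (\<lambda>u. b u v))"

lemma vector_space_field: "vector_space ((*) :: 'f::field \<Rightarrow> 'f \<Rightarrow> 'f)"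
  by unfold_locales (simp_all add: algebra_simps)

lemma vector_space_dual_scale:
  "vector_space (dual_scale :: 'f::field \<Rightarrow> ('v \<Rightarrow> 'f) \<Rightarrow> 'v \<Rightarrow> 'f)"
  by unfold_locales (simp_all add: dual_scale_def fun_eq_iff algebra_simps)

lemma lie_module_dual:
  assumes "lie_module scl br scv UNIV act"
  shows "lie_module scl br dual_scale (dual_space scv) (dual_act act)"
proof -
  interpret V: lie_module scl br scv UNIV act by fact
  interpret F: vector_space "(*) :: 'a \<Rightarrow> 'a \<Rightarrow> 'a" by (rule vector_space_field)
  interpret D: vector_space "dual_scale :: 'a \<Rightarrow> ('c \<Rightarrow> 'a) \<Rightarrow> 'c \<Rightarrow> 'a"
    by (rule vector_space_dual_scale)
  have lin: "Vector_Spaces.linear scv (*) f \<longleftrightarrow>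
      (\<forall>u v. f (u + v) = f u + f v) \<and> (\<forall>c v. f (scv c v) = c * f v)" for f :: "'c \<Rightarrow> 'a"
    by (simp add: module_hom_iff_linear[symmetric] module_hom_iff V.M.module_axioms F.module_axioms)
  have add: "act x (u + v) = act x u + act x v"
    and scale: "act x (scv c v) = scv c (act x v)"
    and addl: "act (x + y) v = act x v + act y v"
    and scalel: "act (scl c x) v = scv c (act x v)"
    and brk: "act (br x y) v = act x (act y v) - act y (act x v)" for x y u v c
    by (simp_all add: V.act_add_right V.act_scale_right V.act_add_left V.act_scale_left V.act_br)
  have diff: "f (u - v) = f u - f v" if "\<forall>u v. f (u + v) = f u + f v" for f :: "'c \<Rightarrow> 'a" and u v
    using that[rule_format, of "u - v" v] by simp
  show ?thesis
  proof
    show "D.subspace (dual_space scv)"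
      by (rule D.subspaceI)
        (simp_all add: dual_space_def lin dual_scale_def distrib_left mult.left_commute add_ac)
  next
    fix f x y c
    assume "f \<in> dual_space scv"
    then have f: "\<forall>u v. f (u + v) = f u + f v" "\<forall>c v. f (scv c v) = c * f v"
      by (simp_all add: dual_space_def lin)
    show "dual_act act x f \<in> dual_space scv"
      by (simp add: dual_space_def lin dual_act_def f add scale)
    show "dual_act act (x + y) f = dual_act act x f + dual_act act y f"
      by (simp add: fun_eq_iff dual_act_def f addl)
    show "dual_act act (scl c x) f = dual_scale c (dual_act act x f)"
      by (simp add: fun_eq_iff dual_act_def dual_scale_def f scalel)
    show "dual_act act (br x y) f =
        dual_act act x (dual_act act y f) - dual_act act y (dual_act act x f)"
      by (simp add: fun_eq_iff dual_act_def brk diff[OF f(1)])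
  qed (simp_all add: fun_eq_iff dual_act_def dual_scale_def)
qed


section \<open>Lie algebras presented by generators and relations\<close>

datatype ('f, 'g) lie_term =
    Gen 'g
  | Zero
  | Add "('f, 'g) lie_term" "('f, 'g) lie_term"
  | Scale 'f "('f, 'g) lie_term"
  | Bracket "('f, 'g) lie_term" "('f, 'g) lie_term"

text \<open>
  \<open>lie_eq R\<close> is the least congruence on terms that contains \<open>R\<close> and satisfies the identities
  of a Lie algebra; its classes form the Lie algebra presented by \<open>R\<close>.
\<close>

inductive lie_eq ::
  "(('f::field, 'g) lie_term \<Rightarrow> ('f, 'g) lie_term \<Rightarrow> bool) \<Rightarrow>
   ('f, 'g) lie_term \<Rightarrow> ('f, 'g) lie_term \<Rightarrow> bool"
  for R where
  rel: "R s t \<Longrightarrow> lie_eq R s t"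
| refl: "lie_eq R t t"
| sym: "lie_eq R s t \<Longrightarrow> lie_eq R t s"
| trans: "lie_eq R s t \<Longrightarrow> lie_eq R t u \<Longrightarrow> lie_eq R s u"
| cong_Add: "lie_eq R s s' \<Longrightarrow> lie_eq R t t' \<Longrightarrow> lie_eq R (Add s t) (Add s' t')"
| cong_Scale: "lie_eq R t t' \<Longrightarrow> lie_eq R (Scale c t) (Scale c t')"
| cong_Bracket: "lie_eq R s s' \<Longrightarrow> lie_eq R t t' \<Longrightarrow> lie_eq R (Bracket s t) (Bracket s' t')"
| add_assoc: "lie_eq R (Add (Add s t) u) (Add s (Add t u))"
| add_comm: "lie_eq R (Add s t) (Add t s)"
| add_zero: "lie_eq R (Add Zero t) t"
| scale_zero: "lie_eq R (Scale 0 t) Zero"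
| scale_one: "lie_eq R (Scale 1 t) t"
| scale_scale: "lie_eq R (Scale c (Scale d t)) (Scale (c * d) t)"
| scale_add_right: "lie_eq R (Scale c (Add s t)) (Add (Scale c s) (Scale c t))"
| scale_add_left: "lie_eq R (Scale (c + d) t) (Add (Scale c t) (Scale d t))"
| bracket_add_left: "lie_eq R (Bracket (Add s t) u) (Add (Bracket s u) (Bracket t u))"
| bracket_add_right: "lie_eq R (Bracket s (Add t u)) (Add (Bracket s t) (Bracket s u))"
| bracket_scale_left: "lie_eq R (Bracket (Scale c s) t) (Scale c (Bracket s t))"
| bracket_scale_right: "lie_eq R (Bracket s (Scale c t)) (Scale c (Bracket s t))"
| bracket_self: "lie_eq R (Bracket t t) Zero"
| bracket_jacobi:
    "lie_eq R (Add (Add (Bracket s (Bracket t u)) (Bracket t (Bracket u s)))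
                   (Bracket u (Bracket s t))) Zero"


section \<open>The tetrahedron algebra\<close>

text \<open>The index set \<open>{0, 1, 2, 3}\<close> is the numeral type \<open>4\<close>.\<close>

typedef tet_gen = "{(i, j). i \<noteq> j} :: (4 \<times> 4) set"
proof -
  have "(0, 1) \<in> ({(i, j). i \<noteq> j} :: (4 \<times> 4) set)" by simp
  then show ?thesis by blast
qed

text \<open>Only meaningful for \<open>i \<noteq> j\<close>.\<close>

definition X :: "4 \<Rightarrow> 4 \<Rightarrow> ('f, tet_gen) lie_term" where
  "X i j = Gen (Abs_tet_gen (i, j))"

inductive tet_rel ::
  "('f::field, tet_gen) lie_term \<Rightarrow> ('f, tet_gen) lie_term \<Rightarrow> bool" where
  skew: "i \<noteq> j \<Longrightarrow> tet_rel (Add (X i j) (X j i)) Zero"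
| triangle: "distinct [i, j, k] \<Longrightarrow>
    tet_rel (Bracket (X i j) (X j k)) (Add (Scale 2 (X i j)) (Scale 2 (X j k)))"
| dolan_grady: "distinct [i, j, k, l] \<Longrightarrow>
    tet_rel (Bracket (X i j) (Bracket (X i j) (Bracket (X i j) (X k l))))
            (Scale 4 (Bracket (X i j) (X k l)))"

quotient_type (overloaded) 'f tetrahedron =
  "('f::field, tet_gen) lie_term" / "lie_eq (tet_rel :: ('f, tet_gen) lie_term \<Rightarrow> _)"
  by (rule equivpI) (auto simp: reflp_def symp_def transp_def intro: lie_eq.refl lie_eq.sym lie_eq.trans)

lemma tetrahedron_cases:
  obtains t where "a = abs_tetrahedron t"
  by (metis Quotient3_abs_rep[OF Quotient3_tetrahedron])

instantiation tetrahedron :: (field) ab_group_add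
begin

lift_definition zero_tetrahedron :: "'a tetrahedron" is Zero .

lift_definition plus_tetrahedron :: "'a tetrahedron \<Rightarrow> 'a tetrahedron \<Rightarrow> 'a tetrahedron" is Add
  by (rule lie_eq.cong_Add)

lift_definition uminus_tetrahedron :: "'a tetrahedron \<Rightarrow> 'a tetrahedron" is "Scale (- 1)"
  by (rule lie_eq.cong_Scale)

lift_definition minus_tetrahedron :: "'a tetrahedron \<Rightarrow> 'a tetrahedron \<Rightarrow> 'a tetrahedron"
  is "\<lambda>s t. Add s (Scale (- 1) t)"
  by (intro lie_eq.cong_Add lie_eq.cong_Scale)

instance
proof
  fix a b c :: "'a tetrahedron"
  show "a + b + c = a + (b + c)" by transfer (rule lie_eq.add_assoc)
  show "a + b = b + a" by transfer (rule lie_eq.add_comm)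
  show "0 + a = a" by transfer (rule lie_eq.add_zero)
  show "a - b = a + - b" by transfer (rule lie_eq.refl)
  show "- a + a = 0"
  proof transfer
    fix t :: "('a, tet_gen) lie_term"
    note [trans] = lie_eq.trans
    have "lie_eq tet_rel (Add (Scale (- 1) t) t) (Add (Scale (- 1) t) (Scale 1 t))"
      by (intro lie_eq.cong_Add lie_eq.refl lie_eq.sym[OF lie_eq.scale_one])
    also have "lie_eq tet_rel \<dots> (Scale (- 1 + 1) t)"
      by (rule lie_eq.sym[OF lie_eq.scale_add_left])
    also have "lie_eq tet_rel \<dots> Zero" using lie_eq.scale_zero by simp
    finally show "lie_eq tet_rel (Add (Scale (- 1) t) t) Zero" .
  qed
qed

end

lift_definition tet_scale :: "'f::field \<Rightarrow> 'f tetrahedron \<Rightarrow> 'f tetrahedron" is Scale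
  by (rule lie_eq.cong_Scale)

lift_definition tet_bracket :: "'f::field tetrahedron \<Rightarrow> 'f tetrahedron \<Rightarrow> 'f tetrahedron"
  is Bracket
  by (rule lie_eq.cong_Bracket)

lift_definition tet_x :: "4 \<Rightarrow> 4 \<Rightarrow> 'f::field tetrahedron" is X .

lemma lie_algebra_tetrahedron:
  "lie_algebra (tet_scale :: 'f::field \<Rightarrow> 'f tetrahedron \<Rightarrow> 'f tetrahedron) tet_bracket"
  by unfold_locales
    (transfer, rule lie_eq.scale_add_right lie_eq.scale_add_left lie_eq.scale_scale lie_eq.scale_one
      lie_eq.bracket_add_left lie_eq.bracket_add_right lie_eq.bracket_scale_left
      lie_eq.bracket_scale_right lie_eq.bracket_self lie_eq.bracket_jacobi)+

lemma tet_x_relations: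
  "i \<noteq> j \<Longrightarrow> tet_x i j + tet_x j i = (0 :: 'f::field tetrahedron)"
  "distinct [i, j, k] \<Longrightarrow>
     tet_bracket (tet_x i j) (tet_x j k) =
       tet_scale (2 :: 'f) (tet_x i j) + tet_scale 2 (tet_x j k)"
  "distinct [i, j, k, l] \<Longrightarrow>
     tet_bracket (tet_x i j) (tet_bracket (tet_x i j) (tet_bracket (tet_x i j) (tet_x k l))) =
       tet_scale (4 :: 'f) (tet_bracket (tet_x i j) (tet_x k l))"
  by (transfer, rule lie_eq.rel, erule tet_rel.intros)+

text \<open>The universal property of the presentation.\<close>

lemma tetrahedron_universal:
  fixes scl :: "'f::field \<Rightarrow> 'l::ab_group_add \<Rightarrow> 'l" and y :: "4 \<Rightarrow> 4 \<Rightarrow> 'l"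
  assumes "lie_algebra scl br"
    and skew: "\<And>i j. i \<noteq> j \<Longrightarrow> y i j + y j i = 0"
    and triangle: "\<And>i j k. distinct [i, j, k] \<Longrightarrow>
      br (y i j) (y j k) = scl 2 (y i j) + scl 2 (y j k)"
    and dolan_grady: "\<And>i j k l. distinct [i, j, k, l] \<Longrightarrow>
      br (y i j) (br (y i j) (br (y i j) (y k l))) = scl 4 (br (y i j) (y k l))"
  shows "\<exists>!h. Vector_Spaces.linear tet_scale scl h \<and>
      (\<forall>a b. h (tet_bracket a b) = br (h a) (h b)) \<and> (\<forall>i j. i \<noteq> j \<longrightarrow> h (tet_x i j) = y i j)"
proof -
  interpret L: lie_algebra scl br by fact
  interpret T: lie_algebra "tet_scale :: 'f \<Rightarrow> _" tet_bracket by (rule lie_algebra_tetrahedron)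
  define ev :: "('f, tet_gen) lie_term \<Rightarrow> 'l" where
    "ev = rec_lie_term (\<lambda>g. case Rep_tet_gen g of (i, j) \<Rightarrow> y i j) 0
       (\<lambda>_ _ a b. a + b) (\<lambda>c _ a. scl c a) (\<lambda>_ _ a b. br a b)"
  have ev[simp]: "ev Zero = 0" "ev (Add s t) = ev s + ev t" "ev (Scale c t) = scl c (ev t)"
    "ev (Bracket s t) = br (ev s) (ev t)" for s t c
    by (simp_all add: ev_def)
  have evX: "ev (X i j) = y i j" if "i \<noteq> j" for i j
    using that by (simp add: ev_def X_def Abs_tet_gen_inverse)
  have rel: "ev s = ev t" if "tet_rel s t" for s t
    using that
  proof cases
    case (skew i j)
    then show ?thesis by (simp add: evX assms(2))
  next
    case (triangle i j k)
    then show ?thesis using assms(3)[of i j k] by (simp add: evX)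
  next
    case (dolan_grady i j k l)
    then show ?thesis using assms(4)[of i j k l] by (simp add: evX)
  qed
  have resp: "ev s = ev t" if "lie_eq tet_rel s t" for s t
    using that
    by induction
      (auto simp: rel L.br_add_left L.br_add_right L.br_scale_left L.br_scale_right
        L.br_self L.jacobi L.scale_right_distrib L.scale_left_distrib)
  define h where "h = (\<lambda>a. ev (rep_tetrahedron a))"
  have h_abs: "h (abs_tetrahedron t) = ev t" for t
    unfolding h_def by (rule resp) (rule Quotient3_rep_abs[OF Quotient3_tetrahedron lie_eq.refl])
  have h_add: "h (a + b) = h a + h b" for a b
    by (cases a rule: tetrahedron_cases, cases b rule: tetrahedron_cases) (simp add: plus_tetrahedron.abs_eq h_abs)
  have h_scale: "h (tet_scale c a) = scl c (h a)" for c a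
    by (cases a rule: tetrahedron_cases) (simp add: tet_scale.abs_eq h_abs)
  have h_br: "h (tet_bracket a b) = br (h a) (h b)" for a b
    by (cases a rule: tetrahedron_cases, cases b rule: tetrahedron_cases) (simp add: tet_bracket.abs_eq h_abs)
  have h_x: "i \<noteq> j \<Longrightarrow> h (tet_x i j) = y i j" for i j
    by (simp add: tet_x.abs_eq h_abs evX)
  show ?thesis
  proof (intro ex1I conjI allI impI)
    show "Vector_Spaces.linear tet_scale scl h"
      by unfold_locales (simp_all add: h_add h_scale)
  next
    fix g
    assume "Vector_Spaces.linear tet_scale scl g \<and>
      (\<forall>a b. g (tet_bracket a b) = br (g a) (g b)) \<and> (\<forall>i j. i \<noteq> j \<longrightarrow> g (tet_x i j) = y i j)"
    then have lin: "Vector_Spaces.linear tet_scale scl g"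
      and g_br: "\<And>a b. g (tet_bracket a b) = br (g a) (g b)"
      and g_x: "\<And>i j. i \<noteq> j \<Longrightarrow> g (tet_x i j) = y i j" by auto
    interpret G: Vector_Spaces.linear tet_scale scl g by fact
    have "g (abs_tetrahedron t) = ev t" for t
    proof (induction t)
      case (Gen p)
      obtain i j where ij: "Rep_tet_gen p = (i, j)" "i \<noteq> j"
        using Rep_tet_gen[of p] by auto
      then have p: "p = Abs_tet_gen (i, j)" by (metis Rep_tet_gen_inverse)
      have "abs_tetrahedron (Gen p) = (tet_x i j :: 'f tetrahedron)" by (simp add: p tet_x.abs_eq X_def)
      moreover have "ev (Gen p) = y i j" by (simp add: ev_def ij)
      ultimately show ?case using g_x[OF ij(2)] by simp
    next
      case Zero
      show ?case using G.zero by (simp add: zero_tetrahedron.abs_eq)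
    next
      case (Add s t)
      then show ?case by (simp add: plus_tetrahedron.abs_eq[symmetric] G.add)
    next
      case (Scale c t)
      then show ?case by (simp add: tet_scale.abs_eq[symmetric] G.scale)
    next
      case (Bracket s t)
      then show ?case by (simp add: tet_bracket.abs_eq[symmetric] g_br)
    qed
    then show "g = h" by (metis tetrahedron_cases h_abs ext)
  qed (simp_all add: h_br h_x)
qed

end

theory Submission
  imports Defs
begin

text \<open>The isomorphism is the form itself, curried: u is sent to the functional
  \<open>form u\<close>. Bilinearity makes this a linear map into the dual space, and invariance of
  the form is exactly equivariance for the dual action. Its kernel is the left radical of the form,
  which is a submodule; since the form is nonzero, irreducibility forces the radical to vanish
  (\<open>irreducible_invariant_form_inj\<close>). In finite dimension the dual is no larger than V,
  so injectivity gives surjectivity (\<open>linear_injective_imp_range_dual_space\<close>).\<close>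

lemma sum_fun_apply: "(\<Sum>i\<in>A. g i) x = (\<Sum>i\<in>A. g i x)"
  for g :: "'a \<Rightarrow> 'b \<Rightarrow> 'c::comm_monoid_add"
  by (induction A rule: infinite_finite_induct) simp_all

lemma linear_injective_imp_range_dual_space:
  fixes scale :: "'f::field \<Rightarrow> 'v::ab_group_add \<Rightarrow> 'v"
  assumes lin: "Vector_Spaces.linear scale dual_scale \<phi>"
    and fd: "finite_dimensional scale (UNIV :: 'v set)"
    and inj: "inj \<phi>"
    and dual: "range \<phi> \<subseteq> dual_space scale"
  shows "range \<phi> = dual_space scale"
proof
  interpret P: Vector_Spaces.linear scale dual_scale \<phi> by fact
  obtain A where A: "finite A" "P.vs1.span A = UNIV"
    using fd by (auto simp: finite_dimensional_def)
  obtain B where B: "B \<subseteq> A" "P.vs1.independent B" "A \<subseteq> P.vs1.span B"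
    using P.vs1.maximal_independent_subset by blast
  have fin: "finite B" using A(1) B(1) by (rule rev_finite_subset)
  have span: "P.vs1.span B = UNIV"
    using P.vs1.span_mono[OF B(3)] A(2) by (auto simp: P.vs1.span_span)
  \<comment> \<open>The coordinate functionals of \<open>B\<close>. Expanding v in \<open>B\<close>
    and applying f shows that f is their combination with coefficients \<open>f b\<close>.\<close>
  define D where "D = (\<lambda>b v. P.vs1.representation B v b) ` B"
  have dual_span: "f \<in> P.vs2.span D" if "f \<in> dual_space scale" for f
  proof -
    interpret f: Vector_Spaces.linear scale "(*)" f
      using that by (simp add: dual_space_def)
    have "f v = (\<Sum>b\<in>B. f b * P.vs1.representation B v b)" for v
    proof -
      have "f v = f (\<Sum>b\<in>B. scale (P.vs1.representation B v b) b)"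
        using B(2) fin span by (simp add: P.vs1.sum_representation_eq)
      then show ?thesis by (simp add: f.sum f.scale mult.commute)
    qed
    then have "f = (\<Sum>b\<in>B. dual_scale (f b) (\<lambda>v. P.vs1.representation B v b))"
      unfolding fun_eq_iff sum_fun_apply dual_scale_def by blast
    also have "\<dots> \<in> P.vs2.span D"
      by (intro P.vs2.span_sum P.vs2.span_scale P.vs2.span_base) (simp add: D_def)
    finally show ?thesis .
  qed
  have indep: "P.vs2.independent (\<phi> ` B)"
    using B(2) inj by (intro P.independent_injective_image) (auto intro: inj_on_subset)
  have card: "card D \<le> card (\<phi> ` B)"
    using card_image_le[OF fin] card_image[OF inj_on_subset[OF inj subset_UNIV]] by (simp add: D_def)
  show "dual_space scale \<subseteq> range \<phi>"
  proof
    fix f assume f: "f \<in> dual_space scale"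
    have "f \<in> P.vs2.span (\<phi> ` B)"
    \<comment> \<open>Otherwise adjoining f would give \<open>card B + 1\<close> independent
      functionals inside the span of the at most \<open>card B\<close> elements of
      \<open>D\<close>.\<close>
    proof (rule ccontr)
      assume notin: "f \<notin> P.vs2.span (\<phi> ` B)"
      then have "P.vs2.independent (insert f (\<phi> ` B))"
        using indep by (rule P.vs2.independent_insertI)
      moreover have "insert f (\<phi> ` B) \<subseteq> P.vs2.span D"
        using dual dual_span f by blast
      moreover have "finite D" using fin by (simp add: D_def)
      ultimately have "card (insert f (\<phi> ` B)) \<le> card D"
        using P.vs2.independent_span_bound by blast
      moreover have "f \<notin> \<phi> ` B" using notin P.vs2.span_base by blast
      ultimately show False using fin card by simp
    qed
    then show "f \<in> range \<phi>" using P.span_image[of B] span by simp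
  qed
qed (fact dual)

text \<open>The kernel of the curried form is its left radical, so it suffices that this radical is
  a proper submodule.\<close>

lemma irreducible_invariant_form_inj:
  assumes irr: "irreducible_lie_module scl br scale UNIV act"
    and bil: "bilinear_form scale form"
    and nz: "\<exists>u v. form u v \<noteq> 0"
    and inv: "\<And>\<xi> u v. form (act \<xi> u) v = - form u (act \<xi> v)"
  shows "inj form"
proof -
  interpret V: lie_module scl br scale UNIV act
    using irr by (simp add: irreducible_lie_module_def)
  interpret form: Vector_Spaces.linear scale "(*)" "\<lambda>u. form u v" for v
    using bil by (simp add: bilinear_form_def)
  let ?W = "{u. \<forall>v. form u v = 0}"
  have "lie_module scl br scale ?W act"
  proof
    show "V.M.subspace ?W"
      by (rule V.M.subspaceI) (simp_all add: form.zero form.add form.scale)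
  \<comment> \<open>Invariance moves the acting element to the second argument, where a vector of
    the radical still pairs to zero; this gives closure under the action.\<close>
  qed (simp_all add: inv V.act_add_left V.act_scale_left V.act_add_right V.act_scale_right V.act_br)
  then have "?W = {0} \<or> ?W = UNIV" using irr by (simp add: irreducible_lie_module_def)
  with nz have W: "?W = {0}" by auto
  show ?thesis
  proof (rule injI)
    fix u u' assume "form u = form u'"
    then have "u - u' \<in> ?W" by (simp add: form.diff)
    then show "u = u'" using W by simp
  qed
qed

theorem theorem18p2:
  fixes scale :: "'f::{alg_closed_field, field_char_0} \<Rightarrow> 'v::ab_group_add \<Rightarrow> 'v"
    and act :: "'f tetrahedron \<Rightarrow> 'v \<Rightarrow> 'v"
    and form :: "'v \<Rightarrow> 'v \<Rightarrow> 'f"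
  assumes "irreducible_lie_module tet_scale tet_bracket scale UNIV act"
    and "finite_dimensional scale (UNIV :: 'v set)"
    and "bilinear_form scale form"
    and "\<exists>u v. form u v \<noteq> 0"
    and "\<And>\<xi> u v. form (act \<xi> u) v = - form u (act \<xi> v)"
  shows "\<exists>\<phi>. lie_module_iso tet_scale tet_bracket scale UNIV act
                dual_scale (dual_space scale) (dual_act act) \<phi> \<and>
             (\<forall>u v. \<phi> u v = form u v)"
proof (intro exI conjI allI)
  have mod: "lie_module tet_scale tet_bracket scale UNIV act"
    using assms(1) by (simp add: irreducible_lie_module_def)
  interpret V: lie_module tet_scale tet_bracket scale UNIV act by (rule mod)
  interpret D: lie_module tet_scale tet_bracket dual_scale "dual_space scale" "dual_act act"
    using mod by (rule lie_module_dual)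
  interpret form: Vector_Spaces.linear scale "(*)" "\<lambda>u. form u v" for v
    using assms(3) by (simp add: bilinear_form_def)
  have add: "form (u + v) = form u + form v" and scale: "form (scale c u) = dual_scale c (form u)"
    for u v c
    by (simp_all add: fun_eq_iff dual_scale_def form.add form.scale)
  have inj: "inj form" using assms(1,3-5) by (rule irreducible_invariant_form_inj)
  have "Vector_Spaces.linear scale dual_scale form"
    by unfold_locales (simp_all add: add scale)
  \<comment> \<open>Linearity in the first argument made \<open>form\<close> a linear map; linearity
    in the second makes each value a functional.\<close>
  moreover have "range form \<subseteq> dual_space scale"
    using assms(3) by (auto simp: bilinear_form_def dual_space_def)
  ultimately have "range form = dual_space scale"
    using linear_injective_imp_range_dual_space assms(2) inj by blast
  \<comment> \<open>This goal fixes the witness as \<open>form\<close>. Equivariance is the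
    invariance hypothesis, whose minus sign is the one in \<open>dual_act\<close>.\<close>
  with inj show "lie_module_iso tet_scale tet_bracket scale UNIV act
      dual_scale (dual_space scale) (dual_act act) form"
    by unfold_locales (simp_all add: bij_betw_def add scale fun_eq_iff dual_act_def assms(5))
qed simp

end
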